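(* Let $X$ be a normal space and let $n,m$ be positive integers with $n\le m$. Let $f_1,\dots,f_n,g_1,\dots,g_m,h_1,\dots,h_m\colon X\to Y$ be fibrewise maps over $B$. Let $\sigma$ and $\beta$ be permutations of $\{1,\dots,m\}$ and $\{1,\dots,n\}$, respectively, and let $1\le s\le m$ and $1\le s'\le n$ be such that $g_{\sigma(i)}\simeq_B g_{\beta(j)}$ for some $i\in\{1,\dots,s\}$ and $j\in\{1,\dots,s'\}$. Then $$D_B(f_1,\dots,f_n,h_1,\dots,h_m)\le D_B(f_1,\dots,f_n,g_{\sigma(1)},\dots,g_{\sigma(s)})+D_B(g_{\beta(1)},\dots,g_{\beta(s')},h_1,\dots,h_m).$$
   Context: All spaces are topological spaces, all maps are continuous, $I=[0,1]$. A fibrewise space over $B$ is a space $X$ with a map $p_X\colon X\to B$; a fibrewise map $f\colon X\to Y$ satisfies $p_Y\circ f=p_X$. Subspaces are fibrewise by restriction. $f\simeq_B g$ means there is $H\colon X\times I\to Y$ with $p_Y(H(x,t))=p_X(x)$, $H(\cdot,0)=f$, $H(\cdot,1)=g$. For fibrewise maps $f_1,\dots,f_r\colon X\to Y$, $D_B(f_1,\dots,f_r)$ is the least $n\ge 0$ (or $\infty$) such that $X$ has an open cover $\{U_0,\dots,U_n\}$ with $f_s|_{U_i}\simeq_B f_t|_{U_i}$ for all $0\le i\le n$, $1\le s,t\le r$. *)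

theory Defs
  imports "HOL-Analysis.Analysis" "HOL-Combinatorics.Permutations"
begin

text \<open>A fibrewise space over \<open>B\<close> is a topology \<open>X\<close> together with a projection \<open>pX\<close> such that
  \<open>continuous_map X B pX\<close>. A subspace \<open>U\<close> of \<open>X\<close> is \<open>subtopology X U\<close> with the same \<open>pX\<close>.\<close>

definition fibrewise_map ::
  "'a topology \<Rightarrow> ('a \<Rightarrow> 'c) \<Rightarrow> 'b topology \<Rightarrow> ('b \<Rightarrow> 'c) \<Rightarrow> ('a \<Rightarrow> 'b) \<Rightarrow> bool" where
  "fibrewise_map X pX Y pY f \<longleftrightarrow>
     continuous_map X Y f \<and> (\<forall>x\<in>topspace X. pY (f x) = pX x)"

definition fibrewise_homotopic ::
  "'a topology \<Rightarrow> ('a \<Rightarrow> 'c) \<Rightarrow> 'b topology \<Rightarrow> ('b \<Rightarrow> 'c) \<Rightarrow> ('a \<Rightarrow> 'b) \<Rightarrow> ('a \<Rightarrow> 'b) \<Rightarrow> bool" where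
  "fibrewise_homotopic X pX Y pY f g \<longleftrightarrow>
     homotopic_with (\<lambda>h. \<forall>x\<in>topspace X. pY (h x) = pX x) X Y f g"

text \<open>The library's homotopies are maps on \<open>I \<times> X\<close> whose end values are prescribed on the whole
  type; the following is the same notion with maps on \<open>X \<times> I\<close>, constrained on the carrier only.\<close>

lemma fibrewise_homotopic_iff:
  "fibrewise_homotopic X pX Y pY f g \<longleftrightarrow>
     (\<exists>H. continuous_map (prod_topology X (top_of_set {0..1::real})) Y H \<and>
          (\<forall>x\<in>topspace X. \<forall>t\<in>{0..1}. pY (H (x, t)) = pX x) \<and>
          (\<forall>x\<in>topspace X. H (x, 0) = f x) \<and>
          (\<forall>x\<in>topspace X. H (x, 1) = g x))" (is "?L \<longleftrightarrow> ?R")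
proof -
  let ?I = "top_of_set {0..1::real}"
  have L: "?L \<longleftrightarrow> (\<exists>h. continuous_map (prod_topology ?I X) Y h \<and>
              (\<forall>x \<in> topspace X. h(0,x) = f x) \<and>
              (\<forall>x \<in> topspace X. h(1,x) = g x) \<and>
              (\<forall>t \<in> {0..1}. \<forall>x\<in>topspace X. pY (h (t,x)) = pX x))"
    unfolding fibrewise_homotopic_def by (rule homotopic_with) simp
  have sw: "continuous_map (prod_topology S T) (prod_topology T S) (\<lambda>(x, y). (y, x))"
    for S :: "'d topology" and T :: "'e topology"
    by (rule homeomorphic_imp_continuous_map [OF homeomorphic_map_swap])
  show ?thesis
  proof
    assume ?L
    then obtain h where "continuous_map (prod_topology ?I X) Y h"
      "\<forall>x \<in> topspace X. h(0,x) = f x" "\<forall>x \<in> topspace X. h(1,x) = g x"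
      "\<forall>t \<in> {0..1}. \<forall>x\<in>topspace X. pY (h (t,x)) = pX x"
      unfolding L by blast
    then show ?R
      by (intro exI [of _ "h \<circ> (\<lambda>(x, y). (y, x))"])
         (auto intro: continuous_map_compose [OF sw])
  next
    assume ?R
    then obtain H where "continuous_map (prod_topology X ?I) Y H"
      "\<forall>x\<in>topspace X. \<forall>t\<in>{0..1}. pY (H (x, t)) = pX x"
      "\<forall>x\<in>topspace X. H (x, 0) = f x" "\<forall>x\<in>topspace X. H (x, 1) = g x"
      by blast
    then show ?L
      unfolding L
      by (intro exI [of _ "H \<circ> (\<lambda>(x, y). (y, x))"])
         (auto intro: continuous_map_compose [OF sw])
  qed
qed

text \<open>The maps \<open>f\<^sub>1, \<dots>, f\<^sub>r\<close> are given as a list. The infimum of the empty set is \<open>\<infinity>\<close>, and an infimum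
  of a nonempty set of extended naturals is its least element.\<close>

definition fibrewise_distance ::
  "'a topology \<Rightarrow> ('a \<Rightarrow> 'c) \<Rightarrow> 'b topology \<Rightarrow> ('b \<Rightarrow> 'c) \<Rightarrow> ('a \<Rightarrow> 'b) list \<Rightarrow> enat" where
  "fibrewise_distance X pX Y pY fs =
     Inf {enat n | n. \<exists>U :: nat \<Rightarrow> 'a set.
       (\<forall>i\<le>n. openin X (U i)) \<and> (\<Union>i\<le>n. U i) = topspace X \<and>
       (\<forall>i\<le>n. \<forall>s<length fs. \<forall>t<length fs.
          fibrewise_homotopic (subtopology X (U i)) pX Y pY (fs ! s) (fs ! t))}"

end

theory Submission
  imports Defs
begin

text \<open>
  Only the case of finite distances on the right needs an argument.
  Let \<open>U\<^sub>0, \<dots>, U\<^sub>k\<close> and \<open>V\<^sub>0, \<dots>, V\<^sub>l\<close> be open covers that realise them.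
  Fix \<open>a\<close> among the \<open>g\<^sub>\<sigma>\<^sub>(\<^sub>i\<^sub>)\<close> and \<open>b\<close> among the \<open>g\<^sub>\<beta>\<^sub>(\<^sub>j\<^sub>)\<close> that are homotopic on all of \<open>X\<close>. On an open
  set contained in a member of each cover, every \<open>f\<close> is homotopic to \<open>a\<close>, hence to \<open>b\<close>, and so
  to every \<open>h\<close>. The point is to find only \<open>k + l + 1\<close> open sets that cover \<open>X\<close> and on which
  these homotopies exist.

  The intersections \<open>U\<^sub>i \<inter> V\<^sub>j\<close> are in general too many. But fibrewise homotopies on pairwise disjoint
  open sets glue together (\<open>fibrewise_homotopic_disjoint_Union\<close>), so it is enough to find \<open>k + l + 1\<close> families of
  pairwise disjoint open sets, each member lying in some \<open>U\<^sub>i \<inter> V\<^sub>j\<close>.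

  Normality gives continuous functions \<open>\<phi>\<^sub>p\<close>, one for each of the \<open>k + l + 2\<close> members of the
  two covers, such that \<open>\<phi>\<^sub>p\<close> is positive only inside the member \<open>p\<close>, and every point has
  \<open>\<phi>\<^sub>p \<ge> 1\<close> for at least one \<open>p\<close> from each cover (\<open>normal_space_cover_functions\<close>). For a set \<open>S\<close> of indices
  let the cell of \<open>S\<close> be the open set of points where the functions indexed by \<open>S\<close> are positive and
  exceed all others. Cells of two different sets of the same size are disjoint, because neither
  index set contains the other. Using only those \<open>S\<close> that meet both index sets, the size of \<open>S\<close> ranges
  over \<open>2, \<dots>, k + l + 2\<close>, which gives \<open>k + l + 1\<close> families; and a point lies in the cell of the
  set of all \<open>p\<close> with \<open>\<phi>\<^sub>p \<ge> 1\<close> there (\<open>normal_space_disjoint_common_refinement\<close>).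
\<close>

section \<open>Common refinements of finite open covers of a normal space\<close>

text \<open>
  Induction on the index set; the closed set \<open>C\<close> is what the remaining members still have to
  cover. The Urysohn function of the new member reaches \<open>2\<close> where no other member helps, so that
  the part of \<open>C\<close> where it is at most \<open>1\<close> is closed and covered by the remaining members.
\<close>

lemma normal_space_cover_functions:
  assumes "normal_space X" "finite I"
    and "\<And>i. i \<in> I \<Longrightarrow> openin X (G i)" "closedin X C" "C \<subseteq> (\<Union>i\<in>I. G i)"
  shows "\<exists>\<phi>::'i \<Rightarrow> 'a \<Rightarrow> real.
    (\<forall>i\<in>I. continuous_map X euclideanreal (\<phi> i) \<and> (\<forall>x\<in>topspace X. 0 < \<phi> i x \<longrightarrow> x \<in> G i)) \<and>
    (\<forall>x\<in>C. \<exists>i\<in>I. 1 \<le> \<phi> i x)"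
  using assms(2-)
proof (induction I arbitrary: C)
  case empty
  then show ?case by auto
next
  case (insert a I)
  let ?V = "\<Union>i\<in>I. G i"
  have "openin X ?V" using insert.prems(1) by blast
  have *: "closedin X (C - ?V)" "closedin X (topspace X - G a)"
    using insert.prems \<open>openin X ?V\<close> by (simp_all add: closedin_diff)
  have "disjnt (topspace X - G a) (C - ?V)"
    using insert.prems(3) by (auto simp: disjnt_def)
  then obtain \<psi> :: "'a \<Rightarrow> real" where \<psi>: "continuous_map X euclideanreal \<psi>"
    "\<psi> ` (topspace X - G a) \<subseteq> {0}" "\<psi> ` (C - ?V) \<subseteq> {2}"
    using Urysohn_lemma_alt [OF assms(1) *(2,1)] by metis
  let ?C = "C \<inter> {x \<in> topspace X. \<psi> x \<in> {..1}}"
  have "closedin X ?C"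
    using insert.prems(2) closedin_continuous_map_preimage [OF \<psi>(1), of "{..1}"]
    by (intro closedin_Int) auto
  moreover have "?C \<subseteq> ?V"
  proof
    fix x assume x: "x \<in> ?C"
    show "x \<in> ?V"
    proof (rule ccontr)
      assume "x \<notin> ?V"
      then have "\<psi> x = 2" using \<psi>(3) x by blast
      then show False using x by simp
    qed
  qed
  ultimately obtain \<phi> :: "'i \<Rightarrow> 'a \<Rightarrow> real" where \<phi>:
    "\<forall>i\<in>I. continuous_map X euclideanreal (\<phi> i) \<and> (\<forall>x\<in>topspace X. 0 < \<phi> i x \<longrightarrow> x \<in> G i)"
    "\<forall>x\<in>?C. \<exists>i\<in>I. 1 \<le> \<phi> i x"
    using insert.IH [of ?C] insert.prems(1) by blast
  have C: "C \<subseteq> topspace X" using insert.prems(2) closedin_subset by blast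
  let ?\<phi> = "\<phi>(a := \<psi>)"
  have "continuous_map X euclideanreal (?\<phi> i) \<and> (\<forall>x\<in>topspace X. 0 < ?\<phi> i x \<longrightarrow> x \<in> G i)"
    if "i \<in> insert a I" for i
  proof (cases "i = a")
    case True
    moreover have "x \<in> G a" if "x \<in> topspace X" "0 < \<psi> x" for x
      using \<psi>(2) that by (cases "x \<in> G a") auto
    ultimately show ?thesis using \<psi>(1) by simp
  next
    case False
    then show ?thesis using \<phi>(1) that by simp
  qed
  moreover have "\<exists>i\<in>insert a I. 1 \<le> ?\<phi> i x" if x: "x \<in> C" for x
  proof (cases "\<psi> x \<le> 1")
    case True
    then have "x \<in> ?C" using x C by auto
    then obtain i where "i \<in> I" "1 \<le> \<phi> i x" using bspec [OF \<phi>(2)] by blast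
    then show ?thesis using insert.hyps(2) by (intro bexI [of _ i]) auto
  qed auto
  ultimately show ?case by (intro exI [of _ ?\<phi>]) simp
qed

definition dominance_cell ::
  "'a topology \<Rightarrow> ('i \<Rightarrow> 'a \<Rightarrow> real) \<Rightarrow> 'i set \<Rightarrow> 'i set \<Rightarrow> 'a set" where
  "dominance_cell X \<phi> K S =
     {x \<in> topspace X. \<forall>p\<in>S. 0 < \<phi> p x \<and> (\<forall>q\<in>K - S. \<phi> q x < \<phi> p x)}"

lemma openin_dominance_cell:
  assumes "finite K" "S \<subseteq> K" and c: "\<And>p. p \<in> K \<Longrightarrow> continuous_map X euclideanreal (\<phi> p)"
  shows "openin X (dominance_cell X \<phi> K S)"
proof -
  have [simp]: "finite S" using assms finite_subset by blast
  have less: "openin X {x \<in> topspace X. u x < v x}"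
    if u: "continuous_map X euclideanreal u" and v: "continuous_map X euclideanreal v" for u v
    using openin_continuous_map_preimage [OF continuous_map_diff [OF v u], of "{0<..}"] by simp
  have "dominance_cell X \<phi> K S = (\<Inter>p\<in>S. {x \<in> topspace X. 0 < \<phi> p x} \<inter>
      ((\<Inter>q\<in>K - S. {x \<in> topspace X. \<phi> q x < \<phi> p x}) \<inter> topspace X)) \<inter> topspace X"
    by (auto simp: dominance_cell_def)
  also have "openin X \<dots>"
  proof (rule openin_INT)
    fix p assume "p \<in> S"
    then have "p \<in> K" using assms(2) by blast
    have "openin X ((\<Inter>q\<in>K - S. {x \<in> topspace X. \<phi> q x < \<phi> p x}) \<inter> topspace X)"
      using assms(1) c \<open>p \<in> K\<close> by (intro openin_INT less) auto
    moreover have "openin X {x \<in> topspace X. 0 < \<phi> p x}"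
      using c \<open>p \<in> K\<close> by (intro less) auto
    ultimately show "openin X ({x \<in> topspace X. 0 < \<phi> p x} \<inter>
        ((\<Inter>q\<in>K - S. {x \<in> topspace X. \<phi> q x < \<phi> p x}) \<inter> topspace X))"
      by (rule openin_Int [rotated])
  qed simp
  finally show ?thesis .
qed

text \<open>
  For distinct \<open>S\<close> and \<open>T\<close> of equal size, take \<open>p \<in> S - T\<close> and \<open>q \<in> T - S\<close>: a common point would
  satisfy both \<open>\<phi>\<^sub>q < \<phi>\<^sub>p\<close> and \<open>\<phi>\<^sub>p < \<phi>\<^sub>q\<close>.
\<close>

lemma disjnt_dominance_cells:
  assumes "finite K" "S \<subseteq> K" "T \<subseteq> K" "card S = card T" "S \<noteq> T"
  shows "disjnt (dominance_cell X \<phi> K S) (dominance_cell X \<phi> K T)"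
proof -
  have "finite S" "finite T" using assms finite_subset by auto
  then have "\<not> S \<subseteq> T" "\<not> T \<subseteq> S" using assms(4,5) card_subset_eq by metis+
  then obtain p q where "p \<in> S" "p \<notin> T" "q \<in> T" "q \<notin> S" by blast
  then have "\<phi> q x < \<phi> p x" if "x \<in> dominance_cell X \<phi> K S" for x
    using assms(3) that by (auto simp: dominance_cell_def)
  moreover have "\<phi> p x < \<phi> q x" if "x \<in> dominance_cell X \<phi> K T" for x
    using assms(2) \<open>p \<in> S\<close> \<open>p \<notin> T\<close> \<open>q \<in> T\<close> that by (auto simp: dominance_cell_def)
  ultimately show ?thesis unfolding disjnt_iff by (meson less_asym)
qed

text \<open>
  The index \<open>r\<close> of a family is the size of the index sets of its cells, less two, since the
  smallest such set has one index from each cover.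
\<close>

lemma normal_space_disjoint_common_refinement:
  fixes U V :: "nat \<Rightarrow> 'a set" and k l :: nat
  assumes X: "normal_space X"
    and U: "\<And>i. i \<le> k \<Longrightarrow> openin X (U i)" "(\<Union>i\<le>k. U i) = topspace X"
    and V: "\<And>j. j \<le> l \<Longrightarrow> openin X (V j)" "(\<Union>j\<le>l. V j) = topspace X"
  obtains \<W> :: "nat \<Rightarrow> 'a set set" where
    "\<And>r. pairwise disjnt (\<W> r)"
    "\<And>r W. W \<in> \<W> r \<Longrightarrow> openin X W \<and> (\<exists>i\<le>k. \<exists>j\<le>l. W \<subseteq> U i \<inter> V j)"
    "(\<Union>r\<le>k + l. \<Union>(\<W> r)) = topspace X"
proof -
  have "\<exists>u. (\<forall>i\<in>{..k}. continuous_map X euclideanreal (u i) \<and>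
      (\<forall>x\<in>topspace X. 0 < u i x \<longrightarrow> x \<in> U i)) \<and> (\<forall>x\<in>topspace X. \<exists>i\<in>{..k}. 1 \<le> u i x)"
    using U by (intro normal_space_cover_functions [OF X]) auto
  then obtain u :: "nat \<Rightarrow> 'a \<Rightarrow> real" where u:
    "\<forall>i\<in>{..k}. continuous_map X euclideanreal (u i) \<and> (\<forall>x\<in>topspace X. 0 < u i x \<longrightarrow> x \<in> U i)"
    "\<forall>x\<in>topspace X. \<exists>i\<in>{..k}. 1 \<le> u i x"
    by blast
  have "\<exists>v. (\<forall>j\<in>{..l}. continuous_map X euclideanreal (v j) \<and>
      (\<forall>x\<in>topspace X. 0 < v j x \<longrightarrow> x \<in> V j)) \<and> (\<forall>x\<in>topspace X. \<exists>j\<in>{..l}. 1 \<le> v j x)"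
    using V by (intro normal_space_cover_functions [OF X]) auto
  then obtain v :: "nat \<Rightarrow> 'a \<Rightarrow> real" where v:
    "\<forall>j\<in>{..l}. continuous_map X euclideanreal (v j) \<and> (\<forall>x\<in>topspace X. 0 < v j x \<longrightarrow> x \<in> V j)"
    "\<forall>x\<in>topspace X. \<exists>j\<in>{..l}. 1 \<le> v j x"
    by blast
  define \<phi> where "\<phi> = case_sum u v"
  define K where "K = {..k} <+> {..l}"
  have K: "finite K" "card K = k + l + 2" by (simp_all add: K_def card_Plus)
  have cont: "continuous_map X euclideanreal (\<phi> p)" if "p \<in> K" for p
    using that u(1) v(1) by (auto simp: \<phi>_def K_def)
  define \<S> where "\<S> r = {S. S \<subseteq> K \<and> card S = r + 2 \<and> (\<exists>i. Inl i \<in> S) \<and> (\<exists>j. Inr j \<in> S)}" for r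
  define \<W> where "\<W> r = dominance_cell X \<phi> K ` \<S> r" for r
  show thesis
  proof
    show "pairwise disjnt (\<W> r)" for r
      unfolding \<W>_def
    proof (rule pairwiseI, elim imageE)
      fix P Q S T
      assume "P \<noteq> Q" "P = dominance_cell X \<phi> K S" "Q = dominance_cell X \<phi> K T" "S \<in> \<S> r" "T \<in> \<S> r"
      then show "disjnt P Q"
        using disjnt_dominance_cells [OF K(1), of S T X \<phi>] by (auto simp: \<S>_def)
    qed
    show "openin X W \<and> (\<exists>i\<le>k. \<exists>j\<le>l. W \<subseteq> U i \<inter> V j)" if W: "W \<in> \<W> r" for r W
    proof -
      obtain S i j where S: "W = dominance_cell X \<phi> K S" "S \<subseteq> K" "Inl i \<in> S" "Inr j \<in> S"
        using W by (auto simp: \<W>_def \<S>_def)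
      have ij: "i \<le> k" "j \<le> l" using S by (auto simp: K_def)
      have "W \<subseteq> topspace X \<inter> {x. 0 < u i x \<and> 0 < v j x}"
        using S by (force simp: dominance_cell_def \<phi>_def)
      then have "W \<subseteq> U i \<inter> V j" using bspec [OF u(1), of i] bspec [OF v(1), of j] ij by auto
      then show ?thesis using openin_dominance_cell [OF K(1) S(2) cont] S(1) ij by auto
    qed
    then have "(\<Union>r\<le>k + l. \<Union>(\<W> r)) \<subseteq> topspace X" using openin_subset by blast
    moreover have "x \<in> (\<Union>r\<le>k + l. \<Union>(\<W> r))" if x: "x \<in> topspace X" for x
    proof -
      obtain i j where ij: "i \<le> k" "1 \<le> u i x" "j \<le> l" "1 \<le> v j x" using u(2) v(2) x by (meson atMost_iff)
      define S where "S = {p \<in> K. 1 \<le> \<phi> p x}"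
      have S: "S \<subseteq> K" "Inl i \<in> S" "Inr j \<in> S" using ij by (auto simp: S_def K_def \<phi>_def)
      have "card {Inl i, Inr j} \<le> card S"
        using S K(1) finite_subset by (intro card_mono) auto
      then have "2 \<le> card S" by simp
      moreover have "card S \<le> k + l + 2" using card_mono [OF K(1) S(1)] K(2) by simp
      ultimately have r: "card S - 2 \<le> k + l" "S \<in> \<S> (card S - 2)"
        using S by (auto simp: \<S>_def)
      \<comment> \<open>Inside \<open>S\<close> the values at \<open>x\<close> are at least \<open>1\<close>, outside they are below \<open>1\<close>.\<close>
      have "x \<in> dominance_cell X \<phi> K S"
        using x by (force simp: dominance_cell_def S_def)
      then have "x \<in> \<Union>(\<W> (card S - 2))" using r(2) by (auto simp: \<W>_def)
      then show ?thesis using r(1) by (intro UN_I [of "card S - 2"]) simp_all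
    qed
    ultimately show "(\<Union>r\<le>k + l. \<Union>(\<W> r)) = topspace X"
      by (rule equalityI [OF _ subsetI])
  qed
qed

section \<open>Fibrewise homotopies over subspaces\<close>

lemma fibrewise_homotopic_sym:
  "fibrewise_homotopic X pX Y pY f g \<Longrightarrow> fibrewise_homotopic X pX Y pY g f"
  unfolding fibrewise_homotopic_def by (rule homotopic_with_symD)

lemma fibrewise_homotopic_trans:
  "fibrewise_homotopic X pX Y pY f g \<Longrightarrow> fibrewise_homotopic X pX Y pY g h
    \<Longrightarrow> fibrewise_homotopic X pX Y pY f h"
  unfolding fibrewise_homotopic_def by (rule homotopic_with_trans)

lemma fibrewise_homotopic_subtopology:
  assumes "fibrewise_homotopic X pX Y pY f g"
  shows "fibrewise_homotopic (subtopology X S) pX Y pY f g"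
proof -
  obtain H where "continuous_map (prod_topology X (top_of_set {0..1::real})) Y H"
    "\<forall>x\<in>topspace X. \<forall>t\<in>{0..1}. pY (H (x, t)) = pX x"
    "\<forall>x\<in>topspace X. H (x, 0) = f x" "\<forall>x\<in>topspace X. H (x, 1) = g x"
    using assms unfolding fibrewise_homotopic_iff by blast
  then show ?thesis
    unfolding fibrewise_homotopic_iff
    by (intro exI [of _ H]) (simp add: prod_topology_subtopology(1) [of X]
        continuous_map_from_subtopology)
qed

lemma fibrewise_homotopic_subset:
  assumes "fibrewise_homotopic (subtopology X T) pX Y pY f g" "S \<subseteq> T"
  shows "fibrewise_homotopic (subtopology X S) pX Y pY f g"
  using fibrewise_homotopic_subtopology [OF assms(1), of S] assms(2)
  by (simp add: subtopology_subtopology Int_absorb1)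

text \<open>
  The sets \<open>W \<times> [0, 1]\<close> form an open cover of the domain of the homotopy and are pairwise
  disjoint, so the homotopies on them paste without any compatibility condition.
\<close>

lemma fibrewise_homotopic_disjoint_Union:
  assumes disj: "pairwise disjnt \<W>" and op: "\<And>W. W \<in> \<W> \<Longrightarrow> openin X W"
    and hom: "\<And>W. W \<in> \<W> \<Longrightarrow> fibrewise_homotopic (subtopology X W) pX Y pY f g"
  shows "fibrewise_homotopic (subtopology X (\<Union>\<W>)) pX Y pY f g"
proof -
  let ?I = "top_of_set {0..1::real}"
  let ?Z = "prod_topology (subtopology X (\<Union>\<W>)) ?I"
  have "\<forall>W\<in>\<W>. \<exists>H. continuous_map (prod_topology (subtopology X W) ?I) Y H \<and>
      (\<forall>x\<in>topspace X \<inter> W. (\<forall>t\<in>{0..1}. pY (H (x, t)) = pX x) \<and> H (x, 0) = f x \<and> H (x, 1) = g x)"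
    using hom unfolding fibrewise_homotopic_iff by simp blast
  then obtain H where H: "\<And>W. W \<in> \<W> \<Longrightarrow> continuous_map (prod_topology (subtopology X W) ?I) Y (H W)"
    "\<And>W x. W \<in> \<W> \<Longrightarrow> x \<in> topspace X \<inter> W \<Longrightarrow>
      (\<forall>t\<in>{0..1}. pY (H W (x, t)) = pX x) \<and> H W (x, 0) = f x \<and> H W (x, 1) = g x"
    by metis
  obtain F where F: "continuous_map ?Z Y F"
    "\<And>z W. W \<in> \<W> \<Longrightarrow> z \<in> topspace ?Z \<inter> W \<times> {0..1} \<Longrightarrow> F z = H W z"
  proof (rule pasting_lemma_exists [where X = ?Z and Y = Y and I = \<W> and T = "\<lambda>W. W \<times> {0..1}" and f = H])
    show "topspace ?Z \<subseteq> (\<Union>W\<in>\<W>. W \<times> {0..1})" by auto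
    show "openin ?Z (W \<times> {0..1})" if "W \<in> \<W>" for W
    proof -
      have "openin (subtopology X (\<Union>\<W>)) W"
        using that op [OF that] unfolding openin_subtopology by blast
      moreover have "openin ?I {0..1}" using openin_topspace [of ?I] by simp
      ultimately show ?thesis by (simp add: openin_prod_Times_iff)
    qed
    show "continuous_map (subtopology ?Z (W \<times> {0..1})) Y (H W)" if "W \<in> \<W>" for W
    proof -
      have "subtopology ?Z (W \<times> {0..1}) = prod_topology (subtopology X W) ?I"
        using that by (simp add: subtopology_Times subtopology_subtopology Int_absorb1 Sup_upper)
      then show ?thesis using H(1) that by simp
    qed
    show "H W z = H W' z"
      if "W \<in> \<W>" "W' \<in> \<W>" "z \<in> topspace ?Z \<inter> W \<times> {0..1} \<inter> W' \<times> {0..1}" for W W' z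
    proof -
      have "W = W'" using that disj unfolding pairwise_def disjnt_iff by blast
      then show ?thesis by simp
    qed
  qed blast
  have "(\<forall>t\<in>{0..1}. pY (F (x, t)) = pX x) \<and> F (x, 0) = f x \<and> F (x, 1) = g x"
    if x: "x \<in> topspace X \<inter> \<Union>\<W>" for x
  proof -
    obtain W where W: "W \<in> \<W>" "x \<in> W" using x by blast
    have "F (x, t) = H W (x, t)" if "t \<in> {0..1}" for t
      using F(2) [OF W(1), of "(x, t)"] W x that by auto
    then show ?thesis using H(2) [OF W(1), of x] W x by auto
  qed
  then show ?thesis
    unfolding fibrewise_homotopic_iff using F(1) by (intro exI [of _ F]) simp
qed

section \<open>The triangle inequality for fibrewise distance\<close>

lemma fibrewise_distance_le:
  assumes "\<And>i. i \<le> n \<Longrightarrow> openin X (U i)" "(\<Union>i\<le>n. U i) = topspace X"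
    and "\<And>i a b. i \<le> n \<Longrightarrow> a \<in> set fs \<Longrightarrow> b \<in> set fs \<Longrightarrow>
      fibrewise_homotopic (subtopology X (U i)) pX Y pY a b"
  shows "fibrewise_distance X pX Y pY fs \<le> enat n"
  unfolding fibrewise_distance_def using assms
  by (intro Inf_lower CollectI exI [of _ n] conjI refl exI [of _ U]) auto

lemma fibrewise_distance_attained:
  assumes "fibrewise_distance X pX Y pY fs \<noteq> \<infinity>"
  obtains n U where "fibrewise_distance X pX Y pY fs = enat n"
    "\<And>i. i \<le> n \<Longrightarrow> openin X (U i)" "(\<Union>i\<le>n. U i) = topspace X"
    "\<And>i a b. i \<le> n \<Longrightarrow> a \<in> set fs \<Longrightarrow> b \<in> set fs \<Longrightarrow>
      fibrewise_homotopic (subtopology X (U i)) pX Y pY a b"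
proof -
  define realised where "realised n U \<longleftrightarrow>
    (\<forall>i\<le>n. openin X (U i)) \<and> (\<Union>i\<le>n. U i) = topspace X \<and>
    (\<forall>i\<le>n. \<forall>s<length fs. \<forall>t<length fs.
      fibrewise_homotopic (subtopology X (U i)) pX Y pY (fs ! s) (fs ! t))"
    for n and U :: "nat \<Rightarrow> 'a set"
  define A where "A = {enat n | n. \<exists>U. realised n U}"
  have A: "fibrewise_distance X pX Y pY fs = Inf A"
    unfolding fibrewise_distance_def A_def realised_def by (rule refl)
  have "A \<noteq> {}"
  proof
    assume "A = {}"
    then have "Inf A = \<infinity>" by (simp add: Inf_enat_def)
    then show False using assms A by simp
  qed
  then have "Inf A \<in> A" using wellorder_InfI by blast
  then obtain n U where n: "Inf A = enat n" and U: "realised n U" unfolding A_def by blast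
  have "fibrewise_homotopic (subtopology X (U i)) pX Y pY a b"
    if i: "i \<le> n" and a: "a \<in> set fs" and b: "b \<in> set fs" for i a b
  proof -
    obtain s t where "s < length fs" "a = fs ! s" "t < length fs" "b = fs ! t"
      using a b by (metis in_set_conv_nth)
    then show ?thesis using U i unfolding realised_def by blast
  qed
  then show thesis using that [of n U] U n A unfolding realised_def by simp
qed

text \<open>
  When both distances are finite, a common refinement of optimal covers consists of \<open>k + l + 1\<close>
  families of disjoint open sets. On each member every map of \<open>fs @ hs\<close> is homotopic to \<open>c\<close>, the
  maps in \<open>hs\<close> by way of \<open>c'\<close>; the union of each family is one set of the new cover.
\<close>

lemma fibrewise_distance_triangle:
  assumes X: "normal_space X"
    and c: "c \<in> set gs" "c' \<in> set gs'" "fibrewise_homotopic X pX Y pY c c'"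
  shows "fibrewise_distance X pX Y pY (fs @ hs)
    \<le> fibrewise_distance X pX Y pY (fs @ gs) + fibrewise_distance X pX Y pY (gs' @ hs)"
proof (cases "fibrewise_distance X pX Y pY (fs @ gs) = \<infinity> \<or>
    fibrewise_distance X pX Y pY (gs' @ hs) = \<infinity>")
  case True
  then show ?thesis by auto
next
  case False
  obtain k U where k: "fibrewise_distance X pX Y pY (fs @ gs) = enat k"
    and U: "\<And>i. i \<le> k \<Longrightarrow> openin X (U i)" "(\<Union>i\<le>k. U i) = topspace X"
    and U_hom: "\<And>i a b. i \<le> k \<Longrightarrow> a \<in> set (fs @ gs) \<Longrightarrow> b \<in> set (fs @ gs) \<Longrightarrow>
      fibrewise_homotopic (subtopology X (U i)) pX Y pY a b"
    using fibrewise_distance_attained False by metis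
  obtain l V where l: "fibrewise_distance X pX Y pY (gs' @ hs) = enat l"
    and V: "\<And>j. j \<le> l \<Longrightarrow> openin X (V j)" "(\<Union>j\<le>l. V j) = topspace X"
    and V_hom: "\<And>j a b. j \<le> l \<Longrightarrow> a \<in> set (gs' @ hs) \<Longrightarrow> b \<in> set (gs' @ hs) \<Longrightarrow>
      fibrewise_homotopic (subtopology X (V j)) pX Y pY a b"
    using fibrewise_distance_attained False by metis
  obtain \<W> where disj: "\<And>r. pairwise disjnt (\<W> r)"
    and small: "\<And>r W. W \<in> \<W> r \<Longrightarrow> openin X W \<and> (\<exists>i\<le>k. \<exists>j\<le>l. W \<subseteq> U i \<inter> V j)"
    and cover: "(\<Union>r\<le>k + l. \<Union>(\<W> r)) = topspace X"
    using normal_space_disjoint_common_refinement [OF X U V] by blast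
  have to_c: "fibrewise_homotopic (subtopology X W) pX Y pY a c"
    if W: "W \<in> \<W> r" and a: "a \<in> set (fs @ hs)" for r W a
  proof -
    obtain i j where ij: "i \<le> k" "j \<le> l" "W \<subseteq> U i" "W \<subseteq> V j" using small [OF W] by blast
    consider "a \<in> set fs" | "a \<in> set hs" using a by auto
    then show ?thesis
    proof cases
      case 1
      then show ?thesis using U_hom [OF ij(1), of a c] c(1) ij(3) fibrewise_homotopic_subset by auto
    next
      case 2
      then have "fibrewise_homotopic (subtopology X W) pX Y pY a c'"
        using V_hom [OF ij(2), of a c'] c(2) ij(4) fibrewise_homotopic_subset by auto
      then show ?thesis
        using fibrewise_homotopic_subtopology [OF fibrewise_homotopic_sym [OF c(3)]]
        by (rule fibrewise_homotopic_trans)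
    qed
  qed
  have "fibrewise_distance X pX Y pY (fs @ hs) \<le> enat (k + l)"
  proof (rule fibrewise_distance_le [OF _ cover])
    show "openin X (\<Union>(\<W> r))" for r using small by blast
    show "fibrewise_homotopic (subtopology X (\<Union>(\<W> r))) pX Y pY a b"
      if "a \<in> set (fs @ hs)" "b \<in> set (fs @ hs)" for r a b
    proof (rule fibrewise_homotopic_disjoint_Union [OF disj])
      show "fibrewise_homotopic (subtopology X W) pX Y pY a b" if "W \<in> \<W> r" for W
        using to_c \<open>a \<in> set (fs @ hs)\<close> \<open>b \<in> set (fs @ hs)\<close> that
          fibrewise_homotopic_trans fibrewise_homotopic_sym by metis
    qed (use small in blast)
  qed
  then show ?thesis by (simp add: k l)
qed

theorem theorem5p10:
  fixes X :: "'a topology" and Y :: "'b topology" and B :: "'c topology"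
    and pX :: "'a \<Rightarrow> 'c" and pY :: "'b \<Rightarrow> 'c"
    and n m s s' :: nat
    and f g h :: "nat \<Rightarrow> 'a \<Rightarrow> 'b"
    and \<sigma> \<beta> :: "nat \<Rightarrow> nat"
  assumes "continuous_map X B pX" and "continuous_map Y B pY"
    and "normal_space X"
    and "1 \<le> n" and "n \<le> m"
    and "\<And>i. i \<in> {1..n} \<Longrightarrow> fibrewise_map X pX Y pY (f i)"
    and "\<And>i. i \<in> {1..m} \<Longrightarrow> fibrewise_map X pX Y pY (g i)"
    and "\<And>i. i \<in> {1..m} \<Longrightarrow> fibrewise_map X pX Y pY (h i)"
    and "\<sigma> permutes {1..m}" and "\<beta> permutes {1..n}"
    and "1 \<le> s" and "s \<le> m" and "1 \<le> s'" and "s' \<le> n"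
    and "\<exists>i\<in>{1..s}. \<exists>j\<in>{1..s'}. fibrewise_homotopic X pX Y pY (g (\<sigma> i)) (g (\<beta> j))"
  shows "fibrewise_distance X pX Y pY (map f [1..<Suc n] @ map h [1..<Suc m])
    \<le> fibrewise_distance X pX Y pY (map f [1..<Suc n] @ map (\<lambda>i. g (\<sigma> i)) [1..<Suc s])
      + fibrewise_distance X pX Y pY (map (\<lambda>j. g (\<beta> j)) [1..<Suc s'] @ map h [1..<Suc m])"
proof -
  obtain i j where ij: "i \<in> {1..s}" "j \<in> {1..s'}"
    and hom: "fibrewise_homotopic X pX Y pY (g (\<sigma> i)) (g (\<beta> j))"
    using assms(15) by blast
  have "g (\<sigma> i) \<in> set (map (\<lambda>i. g (\<sigma> i)) [1..<Suc s])"
    "g (\<beta> j) \<in> set (map (\<lambda>j. g (\<beta> j)) [1..<Suc s'])"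
    using ij by (auto simp del: upt_Suc)
  then show ?thesis
    using fibrewise_distance_triangle [OF \<open>normal_space X\<close> _ _ hom] by blast
qed

end
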